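(* Let $n\ge 1$, let $A_1,\dots,A_n$ be rings, and let $B=A_1\times\cdots\times A_n$ be their direct product. Then $B$ is an ISP-ring if and only if each $A_i$ is an ISP-ring.
   Context: All rings are commutative with a nonzero unit. An element of a ring is regular if it is not a zero-divisor; an ideal is regular if it contains at least one regular element. A proper ideal $H$ is a radical ideal if $\sqrt H=H$. An ideal $J$ of $A$ is invertible if $JJ'=A$ for some $A$-submodule $J'$ of the total quotient ring $T(A)$; equivalently, $J$ is finitely generated, regular, and $J_M$ is a principal ideal of $A_M$ for each maximal ideal $M$ of $A$ (the ideal $A$ itself is allowed). A ring $A$ is an ISP-ring if every proper regular ideal of $A$ can be written as $JH_1\cdots H_n$ with $J$ an invertible ideal, $n\ge 1$, and all $H_i$ proper radical ideals. *)

theory Defs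
  imports "HOL-Algebra.Algebra"
begin

locale nonzero_cring = cring +
  assumes one_neq_zero: "\<one> \<noteq> \<zero>"

definition regular_elements :: "('a, 'm) ring_scheme \<Rightarrow> 'a set" where
  "regular_elements A =
     {s \<in> carrier A. \<forall>x \<in> carrier A. s \<otimes>\<^bsub>A\<^esub> x = \<zero>\<^bsub>A\<^esub> \<longrightarrow> x = \<zero>\<^bsub>A\<^esub>}"

definition proper_ideal :: "'a set \<Rightarrow> ('a, 'm) ring_scheme \<Rightarrow> bool" where
  "proper_ideal I A \<longleftrightarrow> ideal I A \<and> I \<noteq> carrier A"

definition regular_ideal :: "'a set \<Rightarrow> ('a, 'm) ring_scheme \<Rightarrow> bool" where
  "regular_ideal I A \<longleftrightarrow> ideal I A \<and> I \<inter> regular_elements A \<noteq> {}"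

definition radical :: "('a, 'm) ring_scheme \<Rightarrow> 'a set \<Rightarrow> 'a set" where
  "radical A I = {x \<in> carrier A. \<exists>k::nat. k \<ge> 1 \<and> x [^]\<^bsub>A\<^esub> k \<in> I}"

definition proper_radical_ideal :: "'a set \<Rightarrow> ('a, 'm) ring_scheme \<Rightarrow> bool" where
  "proper_radical_ideal H A \<longleftrightarrow> proper_ideal H A \<and> radical A H = H"


text \<open>The total quotient ring \<open>T(A)\<close> consists of the classes \<open>a/s\<close> of pairs with \<open>s\<close> regular.
  Since denominators are regular, \<open>a/s = b/t\<close> is just \<open>at = bs\<close>, without a further factor.
  \<open>T(A)\<close> is given as a \<^typ>\<open>('a, 'b) module\<close> record, so that it is at the same time a ring and
  an \<open>A\<close>-module.\<close>

definition frac_rel :: "('a, 'm) ring_scheme \<Rightarrow> (('a \<times> 'a) \<times> ('a \<times> 'a)) set" where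
  "frac_rel A = {((a, s), (b, t)).
     a \<in> carrier A \<and> s \<in> regular_elements A \<and> b \<in> carrier A \<and> t \<in> regular_elements A \<and>
     a \<otimes>\<^bsub>A\<^esub> t = b \<otimes>\<^bsub>A\<^esub> s}"

definition frac_class :: "('a, 'm) ring_scheme \<Rightarrow> 'a \<Rightarrow> 'a \<Rightarrow> ('a \<times> 'a) set" where
  "frac_class A a s = frac_rel A `` {(a, s)}"

definition total_quotient_ring :: "('a, 'm) ring_scheme \<Rightarrow> ('a, ('a \<times> 'a) set) module" where
  "total_quotient_ring A =
     \<lparr> carrier = (carrier A \<times> regular_elements A) // frac_rel A,
       monoid.mult = (\<lambda>u v. \<Union>(a, s) \<in> u. \<Union>(b, t) \<in> v. frac_class A (a \<otimes>\<^bsub>A\<^esub> b) (s \<otimes>\<^bsub>A\<^esub> t)),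
       one = frac_class A \<one>\<^bsub>A\<^esub> \<one>\<^bsub>A\<^esub>,
       ring.zero = frac_class A \<zero>\<^bsub>A\<^esub> \<one>\<^bsub>A\<^esub>,
       ring.add = (\<lambda>u v. \<Union>(a, s) \<in> u. \<Union>(b, t) \<in> v.
                frac_class A (a \<otimes>\<^bsub>A\<^esub> t \<oplus>\<^bsub>A\<^esub> b \<otimes>\<^bsub>A\<^esub> s) (s \<otimes>\<^bsub>A\<^esub> t)),
       smult = (\<lambda>c u. \<Union>(a, s) \<in> u. frac_class A (c \<otimes>\<^bsub>A\<^esub> a) s) \<rparr>"

definition to_total :: "('a, 'm) ring_scheme \<Rightarrow> 'a \<Rightarrow> ('a \<times> 'a) set" where
  "to_total A a = frac_class A a \<one>\<^bsub>A\<^esub>"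

context cring
begin

lemma regular_elements_one: "\<one> \<in> regular_elements R"
  by (auto simp: regular_elements_def)

lemma regular_elements_closed: "s \<in> regular_elements R \<Longrightarrow> s \<in> carrier R"
  by (simp add: regular_elements_def)

lemma regular_elements_mult:
  assumes "s \<in> regular_elements R" "t \<in> regular_elements R"
  shows "s \<otimes> t \<in> regular_elements R"
proof -
  have c: "s \<in> carrier R" "t \<in> carrier R" using assms by (auto dest: regular_elements_closed)
  have "x = \<zero>" if x: "x \<in> carrier R" and eq: "(s \<otimes> t) \<otimes> x = \<zero>" for x
  proof -
    have "s \<otimes> (t \<otimes> x) = \<zero>" using eq x c by (simp add: m_assoc)
    then have "t \<otimes> x = \<zero>" using assms(1) x c unfolding regular_elements_def by blast
    then show ?thesis using assms(2) x unfolding regular_elements_def by blast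
  qed
  then show ?thesis using c unfolding regular_elements_def by blast
qed

lemma regular_elements_cancel:
  assumes s: "s \<in> regular_elements R" and x: "x \<in> carrier R" and y: "y \<in> carrier R"
    and eq: "s \<otimes> x = s \<otimes> y"
  shows "x = y"
proof -
  have sc: "s \<in> carrier R" using s by (rule regular_elements_closed)
  have "s \<otimes> (x \<ominus> y) = s \<otimes> x \<ominus> s \<otimes> y"
    using sc x y by (simp add: a_minus_def r_distr r_minus)
  also have "\<dots> = \<zero>"
    using eq sc x y by (simp add: a_minus_def r_neg)
  finally have "x \<ominus> y = \<zero>"
    using s x y by (auto simp: regular_elements_def)
  then show ?thesis using x y by (simp add: r_right_minus_eq)
qed

lemma equiv_frac_rel: "equiv (carrier R \<times> regular_elements R) (frac_rel R)"
proof (rule equivI)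
  show "frac_rel R \<subseteq> (carrier R \<times> regular_elements R) \<times> (carrier R \<times> regular_elements R)"
    by (auto simp: frac_rel_def)
  show "refl_on (carrier R \<times> regular_elements R) (frac_rel R)"
    by (auto simp: refl_on_def frac_rel_def)
  show "sym (frac_rel R)"
    by (auto simp: sym_def frac_rel_def)
  show "trans (frac_rel R)"
  proof (rule transI)
    fix p q r assume pq: "(p, q) \<in> frac_rel R" and qr: "(q, r) \<in> frac_rel R"
    obtain a s b t c v where pqr: "p = (a, s)" "q = (b, t)" "r = (c, v)"
      by (metis surj_pair)
    have h: "a \<in> carrier R" "s \<in> regular_elements R" "b \<in> carrier R" "t \<in> regular_elements R"
      "c \<in> carrier R" "v \<in> regular_elements R" "a \<otimes> t = b \<otimes> s" "b \<otimes> v = c \<otimes> t"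
      using pq qr by (auto simp: frac_rel_def pqr)
    then have cl: "s \<in> carrier R" "t \<in> carrier R" "v \<in> carrier R"
      by (auto dest: regular_elements_closed)
    have "t \<otimes> (a \<otimes> v) = (a \<otimes> t) \<otimes> v" using h(1-6) cl by (simp add: m_ac)
    also have "\<dots> = (b \<otimes> v) \<otimes> s" unfolding h(7) using h(1-6) cl by (simp add: m_ac)
    also have "\<dots> = t \<otimes> (c \<otimes> s)" unfolding h(8) using h(1-6) cl by (simp add: m_ac)
    finally have "a \<otimes> v = c \<otimes> s"
      by (rule regular_elements_cancel[OF h(4), rotated 2]) (use h cl in auto)
    then show "(p, r) \<in> frac_rel R" using h by (simp add: frac_rel_def pqr)
  qed
qed

lemma frac_eq_iff:
  assumes "a \<in> carrier R" "s \<in> regular_elements R" "b \<in> carrier R" "t \<in> regular_elements R"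
  shows "frac_class R a s = frac_class R b t \<longleftrightarrow> a \<otimes> t = b \<otimes> s"
  unfolding frac_class_def
  by (subst eq_equiv_class_iff[OF equiv_frac_rel]) (use assms in \<open>auto simp: frac_rel_def\<close>)

lemma mem_frac_iff:
  assumes "a \<in> carrier R" "s \<in> regular_elements R"
  shows "(b, t) \<in> frac_class R a s \<longleftrightarrow>
    b \<in> carrier R \<and> t \<in> regular_elements R \<and> frac_class R b t = frac_class R a s"
proof (cases "b \<in> carrier R \<and> t \<in> regular_elements R")
  case True
  then show ?thesis
    using assms by (auto simp: frac_eq_iff) (auto simp: frac_class_def frac_rel_def)
next
  case False
  then show ?thesis by (auto simp: frac_class_def frac_rel_def)
qed

lemma frac_union:
  assumes "a \<in> carrier R" "s \<in> regular_elements R"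
    and "\<And>a' s'. \<lbrakk>a' \<in> carrier R; s' \<in> regular_elements R; a \<otimes> s' = a' \<otimes> s\<rbrakk> \<Longrightarrow> F a' s' = F a s"
  shows "(\<Union>(a', s') \<in> frac_class R a s. F a' s') = F a s"
proof -
  have eq: "F a' s' = F a s" if "(a', s') \<in> frac_class R a s" for a' s'
    by (rule assms(3)) (use that in \<open>auto simp: frac_class_def frac_rel_def\<close>)
  have "(a, s) \<in> frac_class R a s" using assms(1,2) by (simp add: mem_frac_iff)
  then have "frac_class R a s \<noteq> {}" by blast
  moreover have "case_prod F p = F a s" if "p \<in> frac_class R a s" for p
    using eq[of "fst p" "snd p"] that by (simp add: case_prod_unfold)
  ultimately show ?thesis by (rule SUP_eq_const)
qed

lemma total_quotient_ring_carrier: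
  "carrier (total_quotient_ring R) = {frac_class R a s |a s. a \<in> carrier R \<and> s \<in> regular_elements R}"
  by (auto simp: total_quotient_ring_def quotient_def frac_class_def)

lemma frac_closed:
  "a \<in> carrier R \<Longrightarrow> s \<in> regular_elements R \<Longrightarrow> frac_class R a s \<in> carrier (total_quotient_ring R)"
  by (auto simp: total_quotient_ring_carrier)

lemma total_quotient_ring_one: "\<one>\<^bsub>total_quotient_ring R\<^esub> = frac_class R \<one> \<one>"
  by (simp add: total_quotient_ring_def)

lemma total_quotient_ring_zero: "\<zero>\<^bsub>total_quotient_ring R\<^esub> = frac_class R \<zero> \<one>"
  by (simp add: total_quotient_ring_def)

lemma total_quotient_ring_mult:
  assumes h: "a \<in> carrier R" "s \<in> regular_elements R" "b \<in> carrier R" "t \<in> regular_elements R"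
  shows "frac_class R a s \<otimes>\<^bsub>total_quotient_ring R\<^esub> frac_class R b t = frac_class R (a \<otimes> b) (s \<otimes> t)"
proof -
  have step: "frac_class R (a' \<otimes> b') (s' \<otimes> t') = frac_class R (a'' \<otimes> b'') (s'' \<otimes> t'')"
    if g: "a' \<in> carrier R" "s' \<in> regular_elements R" "b' \<in> carrier R" "t' \<in> regular_elements R"
      "a'' \<in> carrier R" "s'' \<in> regular_elements R" "b'' \<in> carrier R" "t'' \<in> regular_elements R"
      "a'' \<otimes> s' = a' \<otimes> s''" "b'' \<otimes> t' = b' \<otimes> t''"
    for a' s' b' t' a'' s'' b'' t''
  proof -
    note cl = g(1,3,5,7) g(2,4,6,8)[THEN regular_elements_closed]
    have "(a' \<otimes> b') \<otimes> (s'' \<otimes> t'') = (a' \<otimes> s'') \<otimes> (b' \<otimes> t'')" using cl by (simp add: m_ac)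
    also have "\<dots> = (a'' \<otimes> b'') \<otimes> (s' \<otimes> t')" unfolding g(9,10)[symmetric] using cl by (simp add: m_ac)
    finally show ?thesis using g cl by (simp add: frac_eq_iff regular_elements_mult)
  qed
  have inner: "(\<Union>(b', t') \<in> frac_class R b t. frac_class R (a' \<otimes> b') (s' \<otimes> t')) = frac_class R (a' \<otimes> b) (s' \<otimes> t)"
    if "a' \<in> carrier R" "s' \<in> regular_elements R" for a' s'
    by (rule frac_union[OF h(3,4)]) (rule step, use h that in \<open>auto simp: regular_elements_closed\<close>)
  have "frac_class R a s \<otimes>\<^bsub>total_quotient_ring R\<^esub> frac_class R b t =
      (\<Union>(a', s') \<in> frac_class R a s. \<Union>(b', t') \<in> frac_class R b t. frac_class R (a' \<otimes> b') (s' \<otimes> t'))"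
    by (simp add: total_quotient_ring_def)
  also have "\<dots> = (\<Union>(b', t') \<in> frac_class R b t. frac_class R (a \<otimes> b') (s \<otimes> t'))"
    by (rule frac_union[OF h(1,2)], subst (1 2) inner)
      (use h in \<open>auto intro!: step simp: regular_elements_closed del: equalityI\<close>)
  also have "\<dots> = frac_class R (a \<otimes> b) (s \<otimes> t)" by (rule inner[OF h(1,2)])
  finally show ?thesis .
qed

lemma total_quotient_ring_add:
  assumes h: "a \<in> carrier R" "s \<in> regular_elements R" "b \<in> carrier R" "t \<in> regular_elements R"
  shows "frac_class R a s \<oplus>\<^bsub>total_quotient_ring R\<^esub> frac_class R b t = frac_class R (a \<otimes> t \<oplus> b \<otimes> s) (s \<otimes> t)"
proof -
  have step: "frac_class R (a' \<otimes> t' \<oplus> b' \<otimes> s') (s' \<otimes> t') = frac_class R (a'' \<otimes> t'' \<oplus> b'' \<otimes> s'') (s'' \<otimes> t'')"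
    if g: "a' \<in> carrier R" "s' \<in> regular_elements R" "b' \<in> carrier R" "t' \<in> regular_elements R"
      "a'' \<in> carrier R" "s'' \<in> regular_elements R" "b'' \<in> carrier R" "t'' \<in> regular_elements R"
      "a'' \<otimes> s' = a' \<otimes> s''" "b'' \<otimes> t' = b' \<otimes> t''"
    for a' s' b' t' a'' s'' b'' t''
  proof -
    note cl = g(1,3,5,7) g(2,4,6,8)[THEN regular_elements_closed]
    have "(a' \<otimes> t' \<oplus> b' \<otimes> s') \<otimes> (s'' \<otimes> t'') =
        (a' \<otimes> s'') \<otimes> (t' \<otimes> t'') \<oplus> (b' \<otimes> t'') \<otimes> (s' \<otimes> s'')"
      using cl by (simp add: l_distr r_distr m_ac)
    also have "\<dots> = (a'' \<otimes> t'' \<oplus> b'' \<otimes> s'') \<otimes> (s' \<otimes> t')"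
      unfolding g(9,10)[symmetric] using cl by (simp add: l_distr r_distr m_ac)
    finally show ?thesis using g cl by (simp add: frac_eq_iff regular_elements_mult)
  qed
  have inner: "(\<Union>(b', t') \<in> frac_class R b t. frac_class R (a' \<otimes> t' \<oplus> b' \<otimes> s') (s' \<otimes> t')) =
      frac_class R (a' \<otimes> t \<oplus> b \<otimes> s') (s' \<otimes> t)"
    if "a' \<in> carrier R" "s' \<in> regular_elements R" for a' s'
    by (rule frac_union[OF h(3,4)]) (rule step, use h that in \<open>auto simp: regular_elements_closed\<close>)
  have "frac_class R a s \<oplus>\<^bsub>total_quotient_ring R\<^esub> frac_class R b t =
      (\<Union>(a', s') \<in> frac_class R a s. \<Union>(b', t') \<in> frac_class R b t. frac_class R (a' \<otimes> t' \<oplus> b' \<otimes> s') (s' \<otimes> t'))"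
    by (simp add: total_quotient_ring_def)
  also have "\<dots> = (\<Union>(b', t') \<in> frac_class R b t. frac_class R (a \<otimes> t' \<oplus> b' \<otimes> s) (s \<otimes> t'))"
    by (rule frac_union[OF h(1,2)], subst (1 2) inner)
      (use h in \<open>auto intro!: step simp: regular_elements_closed del: equalityI\<close>)
  also have "\<dots> = frac_class R (a \<otimes> t \<oplus> b \<otimes> s) (s \<otimes> t)" by (rule inner[OF h(1,2)])
  finally show ?thesis .
qed

lemma total_quotient_ring_smult:
  assumes h: "c \<in> carrier R" "a \<in> carrier R" "s \<in> regular_elements R"
  shows "c \<odot>\<^bsub>total_quotient_ring R\<^esub> frac_class R a s = frac_class R (c \<otimes> a) s"
proof -
  have "c \<odot>\<^bsub>total_quotient_ring R\<^esub> frac_class R a s = (\<Union>(a', s') \<in> frac_class R a s. frac_class R (c \<otimes> a') s')"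
    by (simp add: total_quotient_ring_def)
  also have "\<dots> = frac_class R (c \<otimes> a) s"
    by (rule frac_union[OF h(2,3)])
      (use h in \<open>simp add: frac_eq_iff regular_elements_closed m_assoc\<close>)
  finally show ?thesis .
qed

lemmas total_quotient_ring_simps =
  total_quotient_ring_one total_quotient_ring_zero total_quotient_ring_mult
  total_quotient_ring_add total_quotient_ring_smult

lemma total_quotient_ring_cring: "cring (total_quotient_ring R)"
proof -
  let ?T = "total_quotient_ring R"
  note [simp] = total_quotient_ring_simps frac_eq_iff regular_elements_one regular_elements_mult
    regular_elements_closed
  have neg: "\<exists>y \<in> carrier ?T. y \<oplus>\<^bsub>?T\<^esub> x = \<zero>\<^bsub>?T\<^esub>" if mem: "x \<in> carrier ?T" for x
  proof -
    obtain a s where x: "x = frac_class R a s" "a \<in> carrier R" "s \<in> regular_elements R"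
      using mem unfolding total_quotient_ring_carrier by blast
    show ?thesis
      by (rule bexI[of _ "frac_class R (\<ominus> a) s"])
        (use x in \<open>auto simp: total_quotient_ring_carrier l_minus l_neg\<close>)
  qed
  show ?thesis
  proof (rule cringI)
    show "abelian_group ?T"
    proof (rule abelian_groupI)
      fix x y z assume "x \<in> carrier ?T" "y \<in> carrier ?T" "z \<in> carrier ?T"
      then obtain a s b t c v where
        xyz: "x = frac_class R a s" "y = frac_class R b t" "z = frac_class R c v"
        and h: "a \<in> carrier R" "b \<in> carrier R" "c \<in> carrier R"
          "s \<in> regular_elements R" "t \<in> regular_elements R" "v \<in> regular_elements R"
        unfolding total_quotient_ring_carrier by blast
      have "(a \<otimes> t \<oplus> b \<otimes> s) \<otimes> v \<oplus> c \<otimes> (s \<otimes> t) = a \<otimes> (t \<otimes> v) \<oplus> (b \<otimes> v \<oplus> c \<otimes> t) \<otimes> s"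
        using h by (simp add: l_distr r_distr m_ac a_assoc)
      then show "x \<oplus>\<^bsub>?T\<^esub> y \<oplus>\<^bsub>?T\<^esub> z = x \<oplus>\<^bsub>?T\<^esub> (y \<oplus>\<^bsub>?T\<^esub> z)"
        using h by (simp add: xyz m_assoc del: frac_eq_iff)
    next
      fix x y assume "x \<in> carrier ?T" "y \<in> carrier ?T"
      then obtain a s b t where
        xy: "x = frac_class R a s" "y = frac_class R b t"
        and h: "a \<in> carrier R" "b \<in> carrier R" "s \<in> regular_elements R" "t \<in> regular_elements R"
        unfolding total_quotient_ring_carrier by blast
      show "x \<oplus>\<^bsub>?T\<^esub> y \<in> carrier ?T" using h by (simp add: xy frac_closed)
      have "a \<otimes> t \<oplus> b \<otimes> s = b \<otimes> s \<oplus> a \<otimes> t" "s \<otimes> t = t \<otimes> s"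
        using h by (auto simp: a_comm m_comm)
      then show "x \<oplus>\<^bsub>?T\<^esub> y = y \<oplus>\<^bsub>?T\<^esub> x"
        using h by (simp add: xy del: frac_eq_iff)
    next
      show "\<zero>\<^bsub>?T\<^esub> \<in> carrier ?T" by (simp add: frac_closed)
    next
      fix x assume x: "x \<in> carrier ?T"
      then obtain a s where "x = frac_class R a s" "a \<in> carrier R" "s \<in> regular_elements R"
        unfolding total_quotient_ring_carrier by blast
      then show "\<zero>\<^bsub>?T\<^esub> \<oplus>\<^bsub>?T\<^esub> x = x" by (simp del: frac_eq_iff)
      show "\<exists>y \<in> carrier ?T. y \<oplus>\<^bsub>?T\<^esub> x = \<zero>\<^bsub>?T\<^esub>" by (rule neg[OF x])
    qed
    show "comm_monoid ?T"
    proof (rule comm_monoidI)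
      fix x y z assume "x \<in> carrier ?T" "y \<in> carrier ?T" "z \<in> carrier ?T"
      then obtain a s b t c v where
        xyz: "x = frac_class R a s" "y = frac_class R b t" "z = frac_class R c v"
        and h: "a \<in> carrier R" "b \<in> carrier R" "c \<in> carrier R"
          "s \<in> regular_elements R" "t \<in> regular_elements R" "v \<in> regular_elements R"
        unfolding total_quotient_ring_carrier by blast
      show "x \<otimes>\<^bsub>?T\<^esub> y \<otimes>\<^bsub>?T\<^esub> z = x \<otimes>\<^bsub>?T\<^esub> (y \<otimes>\<^bsub>?T\<^esub> z)"
        using h by (simp add: xyz m_assoc del: frac_eq_iff)
    next
      fix x y assume "x \<in> carrier ?T" "y \<in> carrier ?T"
      then obtain a s b t where
        xy: "x = frac_class R a s" "y = frac_class R b t"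
        and h: "a \<in> carrier R" "b \<in> carrier R" "s \<in> regular_elements R" "t \<in> regular_elements R"
        unfolding total_quotient_ring_carrier by blast
      show "x \<otimes>\<^bsub>?T\<^esub> y \<in> carrier ?T" using h by (simp add: xy frac_closed)
      have "a \<otimes> b = b \<otimes> a" "s \<otimes> t = t \<otimes> s"
        using h by (auto simp: m_comm)
      then show "x \<otimes>\<^bsub>?T\<^esub> y = y \<otimes>\<^bsub>?T\<^esub> x"
        using h by (simp add: xy del: frac_eq_iff)
    next
      show "\<one>\<^bsub>?T\<^esub> \<in> carrier ?T" by (simp add: frac_closed)
    next
      fix x assume "x \<in> carrier ?T"
      then obtain a s where "x = frac_class R a s" "a \<in> carrier R" "s \<in> regular_elements R"
        unfolding total_quotient_ring_carrier by blast
      then show "\<one>\<^bsub>?T\<^esub> \<otimes>\<^bsub>?T\<^esub> x = x" by (simp del: frac_eq_iff)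
    qed
  next
    fix x y z assume "x \<in> carrier ?T" "y \<in> carrier ?T" "z \<in> carrier ?T"
    then obtain a s b t c v where
      xyz: "x = frac_class R a s" "y = frac_class R b t" "z = frac_class R c v"
      and h: "a \<in> carrier R" "b \<in> carrier R" "c \<in> carrier R"
        "s \<in> regular_elements R" "t \<in> regular_elements R" "v \<in> regular_elements R"
      unfolding total_quotient_ring_carrier by blast
    note cl = h(1-3) h(4-6)[THEN regular_elements_closed]
    have "((a \<otimes> t \<oplus> b \<otimes> s) \<otimes> c) \<otimes> ((s \<otimes> v) \<otimes> (t \<otimes> v)) =
        ((a \<otimes> c) \<otimes> (t \<otimes> v) \<oplus> (b \<otimes> c) \<otimes> (s \<otimes> v)) \<otimes> ((s \<otimes> t) \<otimes> v)"
      using cl by (simp add: l_distr r_distr m_ac del: regular_elements_closed)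
    then show "(x \<oplus>\<^bsub>?T\<^esub> y) \<otimes>\<^bsub>?T\<^esub> z = x \<otimes>\<^bsub>?T\<^esub> z \<oplus>\<^bsub>?T\<^esub> y \<otimes>\<^bsub>?T\<^esub> z"
      using h by (simp add: xyz)
  qed
qed

lemma total_quotient_ring_algebra: "algebra R (total_quotient_ring R)"
proof -
  let ?T = "total_quotient_ring R"
  note [simp] = total_quotient_ring_simps frac_eq_iff regular_elements_one regular_elements_mult
    regular_elements_closed
  show ?thesis
  proof (rule algebraI)
    show "cring R" by (rule is_cring)
    show "cring ?T" by (rule total_quotient_ring_cring)
  next
    fix c x assume c: "c \<in> carrier R" and "x \<in> carrier ?T"
    then obtain a s where "x = frac_class R a s" "a \<in> carrier R" "s \<in> regular_elements R"
      unfolding total_quotient_ring_carrier by blast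
    then show "c \<odot>\<^bsub>?T\<^esub> x \<in> carrier ?T" using c by (simp add: frac_closed)
  next
    fix c d x assume cd: "c \<in> carrier R" "d \<in> carrier R" and "x \<in> carrier ?T"
    then obtain a s where x: "x = frac_class R a s" "a \<in> carrier R" "s \<in> regular_elements R"
      unfolding total_quotient_ring_carrier by blast
    have "((c \<oplus> d) \<otimes> a) \<otimes> (s \<otimes> s) = ((c \<otimes> a) \<otimes> s \<oplus> (d \<otimes> a) \<otimes> s) \<otimes> s"
      using cd x by (simp add: l_distr m_assoc)
    then show "(c \<oplus> d) \<odot>\<^bsub>?T\<^esub> x = c \<odot>\<^bsub>?T\<^esub> x \<oplus>\<^bsub>?T\<^esub> d \<odot>\<^bsub>?T\<^esub> x"
      using cd x by simp
    show "(c \<otimes> d) \<odot>\<^bsub>?T\<^esub> x = c \<odot>\<^bsub>?T\<^esub> (d \<odot>\<^bsub>?T\<^esub> x)"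
      using cd x by (simp add: m_assoc del: frac_eq_iff)
  next
    fix c x y assume c: "c \<in> carrier R" and "x \<in> carrier ?T" "y \<in> carrier ?T"
    then obtain a s b t where
      xy: "x = frac_class R a s" "y = frac_class R b t"
      and h: "a \<in> carrier R" "b \<in> carrier R" "s \<in> regular_elements R" "t \<in> regular_elements R"
      unfolding total_quotient_ring_carrier by blast
    have "c \<otimes> (a \<otimes> t \<oplus> b \<otimes> s) = (c \<otimes> a) \<otimes> t \<oplus> (c \<otimes> b) \<otimes> s"
      using c h by (simp add: r_distr m_assoc)
    then show "c \<odot>\<^bsub>?T\<^esub> (x \<oplus>\<^bsub>?T\<^esub> y) = c \<odot>\<^bsub>?T\<^esub> x \<oplus>\<^bsub>?T\<^esub> c \<odot>\<^bsub>?T\<^esub> y"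
      using c h by (simp add: xy del: frac_eq_iff)
    show "(c \<odot>\<^bsub>?T\<^esub> x) \<otimes>\<^bsub>?T\<^esub> y = c \<odot>\<^bsub>?T\<^esub> (x \<otimes>\<^bsub>?T\<^esub> y)"
      using c h by (simp add: xy m_assoc del: frac_eq_iff)
  next
    fix x assume "x \<in> carrier ?T"
    then obtain a s where "x = frac_class R a s" "a \<in> carrier R" "s \<in> regular_elements R"
      unfolding total_quotient_ring_carrier by blast
    then show "\<one> \<odot>\<^bsub>?T\<^esub> x = x" by (simp del: frac_eq_iff)
  qed
qed

lemma to_total_hom: "to_total R \<in> ring_hom R (total_quotient_ring R)"
  by (rule ring_hom_memI)
    (auto simp: to_total_def total_quotient_ring_simps regular_elements_one
      intro: frac_closed del: equalityI)

lemma to_total_inj: "inj_on (to_total R) (carrier R)"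
  by (auto simp: inj_on_def to_total_def frac_eq_iff regular_elements_one)

lemma to_total_regular_Units:
  assumes "s \<in> regular_elements R"
  shows "to_total R s \<in> Units (total_quotient_ring R)"
proof -
  note [simp] = total_quotient_ring_simps frac_eq_iff regular_elements_one regular_elements_mult
    regular_elements_closed
  have "frac_class R \<one> s \<in> carrier (total_quotient_ring R)" "to_total R s \<in> carrier (total_quotient_ring R)"
    using assms by (auto simp: to_total_def intro!: frac_closed)
  moreover have "frac_class R \<one> s \<otimes>\<^bsub>total_quotient_ring R\<^esub> to_total R s = \<one>\<^bsub>total_quotient_ring R\<^esub>"
    "to_total R s \<otimes>\<^bsub>total_quotient_ring R\<^esub> frac_class R \<one> s = \<one>\<^bsub>total_quotient_ring R\<^esub>"
    using assms by (auto simp: to_total_def)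
  ultimately show ?thesis unfolding Units_def by blast
qed

end

text \<open>The product \<open>JJ'\<close> is formed in \<open>T(A)\<close>; \<^const>\<open>ideal_prod\<close> yields the set of all finite
  nonempty sums of products for arbitrary subsets of a ring, not only for ideals.\<close>

definition invertible_ideal :: "'a set \<Rightarrow> ('a, 'm) ring_scheme \<Rightarrow> bool" where
  "invertible_ideal J A \<longleftrightarrow> ideal J A \<and>
     (\<exists>J'. submodule J' A (total_quotient_ring A) \<and>
           (to_total A ` J) \<cdot>\<^bsub>total_quotient_ring A\<^esub> J' = to_total A ` carrier A)"

text \<open>\<open>foldl (ideal_prod A) J [H\<^sub>1, \<dots>, H\<^sub>n]\<close> is the ideal product
  \<open>(\<dots>(JH\<^sub>1)\<dots>)H\<^sub>n\<close>.\<close>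

definition ISP_ring :: "('a, 'm) ring_scheme \<Rightarrow> bool" where
  "ISP_ring A \<longleftrightarrow> nonzero_cring A \<and>
     (\<forall>I. proper_ideal I A \<and> regular_ideal I A \<longrightarrow>
        (\<exists>J Hs. invertible_ideal J A \<and> length Hs \<ge> 1 \<and>
                (\<forall>H \<in> set Hs. proper_radical_ideal H A) \<and>
                I = foldl (ideal_prod A) J Hs))"

end

theory Submission
  imports Defs
begin

text \<open>Clearing denominators, an ideal \<open>J\<close> is invertible iff \<open>JK = sA\<close> for some ideal \<open>K\<close> and some
  regular \<open>s\<close>, so the total quotient ring of a product need not be computed. The ideals of a product
  \<open>R \<times> S\<close> are the \<open>I \<times> K\<close>, and products, invertibility and regularity are componentwise. A
  factorization of \<open>I \<times> S\<close> projects to one of \<open>I\<close>: its radical factors contain \<open>I \<times> S\<close>, so they are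
  proper in the first component. Conversely, factorizations \<open>I = J\<^sub>1 \<Prod>H\<^sub>i\<close> and \<open>K = J\<^sub>2 \<Prod>H'\<^sub>j\<close>
  combine to \<open>I \<times> K = (J\<^sub>1 \<times> J\<^sub>2) \<Prod>(H\<^sub>i \<times> S) \<Prod>(R \<times> H'\<^sub>j)\<close>.\<close>

section \<open>Ideals and ring homomorphisms\<close>

text \<open>Negatives come for free as multiples by \<open>\<ominus> \<one>\<close>, and
  commutativity makes absorption on one side sufficient.\<close>

lemma (in cring) ideal_cringI:
  assumes sub: "I \<subseteq> carrier R" and zero: "\<zero> \<in> I"
    and add: "\<And>a b. a \<in> I \<Longrightarrow> b \<in> I \<Longrightarrow> a \<oplus> b \<in> I"
    and mult: "\<And>a x. a \<in> I \<Longrightarrow> x \<in> carrier R \<Longrightarrow> x \<otimes> a \<in> I"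
  shows "ideal I R"
proof (rule idealI)
  show "ring R" by (rule ring_axioms)
  show "subgroup I (add_monoid R)"
  proof (rule add.subgroupI)
    fix a assume a: "a \<in> I"
    then have "\<ominus> a = (\<ominus> \<one>) \<otimes> a" using sub by (auto simp: l_minus)
    then show "\<ominus> a \<in> I" using mult[OF a, of "\<ominus> \<one>"] by simp
  qed (use assms in auto)
  fix a x assume ax: "a \<in> I" "x \<in> carrier R"
  then show "x \<otimes> a \<in> I" by (rule mult)
  then show "a \<otimes> x \<in> I" using ax sub by (metis m_comm subsetD)
qed

lemma (in ring) ideal_prod_least:
  assumes "ideal L R" and "\<And>i j. i \<in> I \<Longrightarrow> j \<in> J \<Longrightarrow> i \<otimes> j \<in> L"
  shows "I \<cdot> J \<subseteq> L"
proof
  fix x assume "x \<in> I \<cdot> J"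
  then show "x \<in> L"
    by induct (use assms in \<open>auto intro: additive_subgroup.a_closed ideal.axioms(1)\<close>)
qed

lemma (in ring) foldl_ideal_prod_ideal:
  assumes "ideal J R" and "\<forall>H\<in>set Hs. ideal H R"
  shows "ideal (foldl (ideal_prod R) J Hs) R"
  using assms by (induct Hs arbitrary: J) (auto simp: ideal_prod_is_ideal)

text \<open>Factors coming from the other component of a product ring project to unit ideals; this
  removes them.\<close>

lemma (in ring) foldl_ideal_prod_one:
  assumes "ideal J R"
  shows "foldl (ideal_prod R) J (replicate n (carrier R)) = J"
  using assms by (induct n) (auto simp: ideal_prod_one)

text \<open>A product of ideals lies in each of its factors. For a product of the form I \<times> S
  this forces every factor to be full in the second component.\<close>

lemma (in ring) foldl_ideal_prod_subset:
  assumes "ideal J R" and "\<forall>H\<in>set Hs. ideal H R"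
  shows "foldl (ideal_prod R) J Hs \<subseteq> J \<and> (\<forall>H\<in>set Hs. foldl (ideal_prod R) J Hs \<subseteq> H)"
  using assms
proof (induct Hs arbitrary: J)
  case (Cons H Hs)
  then have "ideal (J \<cdot> H) R" "J \<cdot> H \<subseteq> J \<inter> H"
    using ideal_prod_is_ideal[of J H] ideal_prod_inter[of J H] by simp_all
  then show ?case using Cons.hyps[of "J \<cdot> H"] Cons.prems by auto
qed simp

context ring_hom_ring
begin

lemma img_ideal_prod:
  assumes I: "I \<subseteq> carrier R" and J: "J \<subseteq> carrier R"
  shows "h ` (I \<cdot>\<^bsub>R\<^esub> J) = (h ` I) \<cdot>\<^bsub>S\<^esub> (h ` J)"
proof
  \<comment> \<open>Membership in the carrier is carried through the induction because
    \<open>h\<close> is known to be additive only there.\<close>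
  have "x \<in> carrier R \<and> h x \<in> (h ` I) \<cdot>\<^bsub>S\<^esub> (h ` J)" if "x \<in> I \<cdot>\<^bsub>R\<^esub> J" for x
    using that
  proof induct
    case (prod i j)
    then show ?case using I J by (auto simp: subset_iff intro!: ideal_prod.prod)
  next
    case (sum x y)
    then show ?case by (auto intro: ideal_prod.sum)
  qed
  then show "h ` (I \<cdot>\<^bsub>R\<^esub> J) \<subseteq> (h ` I) \<cdot>\<^bsub>S\<^esub> (h ` J)" by blast
next
  have "\<exists>x \<in> I \<cdot>\<^bsub>R\<^esub> J. x \<in> carrier R \<and> y = h x" if "y \<in> (h ` I) \<cdot>\<^bsub>S\<^esub> (h ` J)" for y
    using that
  proof induct
    case (prod u v)
    then obtain i j where "i \<in> I" "j \<in> J" "u = h i" "v = h j" by blast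
    then show ?case using I J
      by (intro bexI[of _ "i \<otimes>\<^bsub>R\<^esub> j"]) (auto simp: subset_iff intro: ideal_prod.prod)
  next
    case (sum u v)
    then obtain x y where "x \<in> I \<cdot>\<^bsub>R\<^esub> J" "y \<in> I \<cdot>\<^bsub>R\<^esub> J" "x \<in> carrier R" "y \<in> carrier R"
      "u = h x" "v = h y" by blast
    then show ?case
      by (intro bexI[of _ "x \<oplus>\<^bsub>R\<^esub> y"]) (auto intro: ideal_prod.sum)
  qed
  then show "(h ` I) \<cdot>\<^bsub>S\<^esub> (h ` J) \<subseteq> h ` (I \<cdot>\<^bsub>R\<^esub> J)" by blast
qed

lemma img_foldl_ideal_prod:
  assumes "ideal J R" and "\<forall>H\<in>set Hs. ideal H R"
  shows "h ` foldl (ideal_prod R) J Hs = foldl (ideal_prod S) (h ` J) (map ((`) h) Hs)"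
  using assms
proof (induct Hs arbitrary: J)
  case (Cons H Hs)
  then show ?case
    by (auto simp: img_ideal_prod ideal.Icarr subsetI R.ideal_prod_is_ideal)
qed simp

text \<open>Surjectivity is what lifts the multiplier of an arbitrary multiple of \<open>h a\<close>
  back to R.\<close>

lemma img_cgenideal:
  assumes "h ` carrier R = carrier S" and "a \<in> carrier R"
  shows "h ` (PIdl\<^bsub>R\<^esub> a) = PIdl\<^bsub>S\<^esub> (h a)"
proof
  show "h ` (PIdl\<^bsub>R\<^esub> a) \<subseteq> PIdl\<^bsub>S\<^esub> (h a)"
    using assms(2) by (auto simp: cgenideal_def)
  show "PIdl\<^bsub>S\<^esub> (h a) \<subseteq> h ` (PIdl\<^bsub>R\<^esub> a)"
  proof
    fix y assume "y \<in> PIdl\<^bsub>S\<^esub> (h a)"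
    then obtain x where "x \<in> carrier R" "y = h x \<otimes>\<^bsub>S\<^esub> h a"
      unfolding cgenideal_def assms(1)[symmetric] by blast
    then have "y = h (x \<otimes>\<^bsub>R\<^esub> a)" "x \<otimes>\<^bsub>R\<^esub> a \<in> PIdl\<^bsub>R\<^esub> a" using assms(2) by (auto simp: cgenideal_def)
    then show "y \<in> h ` (PIdl\<^bsub>R\<^esub> a)" by blast
  qed
qed

end

section \<open>Invertible ideals without fractions\<close>

context cring
begin

text \<open>This is the part of sJ' that lies in R. For a suitable \<open>s\<close> it serves as the
  cofactor K with JK = sR.\<close>

lemma numerators_ideal:
  assumes J': "submodule J' R (total_quotient_ring R)" and s: "s \<in> regular_elements R"
  shows "ideal {a \<in> carrier R. frac_class R a s \<in> J'} R" (is "ideal ?K R")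
proof -
  interpret T: module R "total_quotient_ring R"
    using total_quotient_ring_algebra by (simp add: algebra_def)
  interpret J': submodule J' R "total_quotient_ring R" by (rule J')
  have sc: "s \<in> carrier R" using s by (rule regular_elements_closed)
  show ?thesis
  proof (rule ideal_cringI)
    have "frac_class R \<zero> s = \<zero>\<^bsub>total_quotient_ring R\<^esub>"
      using s sc by (simp add: total_quotient_ring_zero frac_eq_iff regular_elements_one)
    then show "\<zero> \<in> ?K" using J'.one_closed by simp
  next
    fix a b assume ab: "a \<in> ?K" "b \<in> ?K"
    then have "(a \<otimes> s \<oplus> b \<otimes> s) \<otimes> s = (a \<oplus> b) \<otimes> (s \<otimes> s)"
      using sc by (simp add: l_distr m_assoc)
    then have "frac_class R a s \<oplus>\<^bsub>total_quotient_ring R\<^esub> frac_class R b s = frac_class R (a \<oplus> b) s"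
      using s sc ab by (simp add: total_quotient_ring_add frac_eq_iff regular_elements_mult)
    then show "a \<oplus> b \<in> ?K" using ab J'.m_closed by fastforce
  next
    fix a x assume "a \<in> ?K" "x \<in> carrier R"
    then show "x \<otimes> a \<in> ?K"
      using J'.smult_closed[of x "frac_class R a s"] s by (simp add: total_quotient_ring_smult)
  qed auto
qed

text \<open>An element of JJ' is a finite sum of terms j(a/s). Two summands are brought over the
  product of their denominators, and the new numerators remain in J times the numerators of J' over
  that denominator.\<close>

lemma ideal_prod_common_denominator:
  assumes J: "ideal J R" and J': "submodule J' R (total_quotient_ring R)"
    and x: "x \<in> (to_total R ` J) \<cdot>\<^bsub>total_quotient_ring R\<^esub> J'"
  shows "\<exists>s c. s \<in> regular_elements R \<and> c \<in> J \<cdot> {a \<in> carrier R. frac_class R a s \<in> J'} \<and>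
    x = frac_class R c s"
  using x
proof induct
  case (prod i u)
  then obtain j where j: "j \<in> J" "i = to_total R j" by blast
  have "u \<in> carrier (total_quotient_ring R)"
    using prod(2) subgroup.subset[OF submodule.axioms(1)[OF J']] by auto
  then obtain a s where u: "u = frac_class R a s" "a \<in> carrier R" "s \<in> regular_elements R"
    unfolding total_quotient_ring_carrier by blast
  have "j \<in> carrier R" using j ideal.Icarr[OF J] by blast
  then have "i \<otimes>\<^bsub>total_quotient_ring R\<^esub> u = frac_class R (j \<otimes> a) s"
    using u j by (simp add: to_total_def total_quotient_ring_mult regular_elements_one regular_elements_closed)
  moreover have "j \<otimes> a \<in> J \<cdot> {a \<in> carrier R. frac_class R a s \<in> J'}"
    using u j prod(2) by (intro ideal_prod.prod) auto
  ultimately show ?case using u by blast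
next
  case (sum x y)
  let ?K = "\<lambda>s. {a \<in> carrier R. frac_class R a s \<in> J'}"
  have KI: "ideal (J \<cdot> ?K s) R" if "s \<in> regular_elements R" for s
    using ideal_prod_is_ideal[OF J numerators_ideal[OF J' that]] .
  \<comment> \<open>Expanding a/s by \<open>t\<close> does not change the fraction, so it still lies
    in J'.\<close>
  have K_mult: "a \<otimes> t \<in> ?K (s \<otimes> t)"
    if "a \<in> ?K s" "s \<in> regular_elements R" "t \<in> regular_elements R" for a s t
  proof -
    note cl = that(2,3)[THEN regular_elements_closed]
    have "frac_class R (a \<otimes> t) (s \<otimes> t) = frac_class R a s"
      using that cl by (simp add: frac_eq_iff regular_elements_mult m_ac)
    then show ?thesis using that cl by simp
  qed
  \<comment> \<open>The expansion passes from single numerators to sums of products, by induction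
    over the generation of the ideal product.\<close>
  have JK_mult: "c \<otimes> t \<in> J \<cdot> ?K (s \<otimes> t)"
    if c: "c \<in> J \<cdot> ?K s" and s: "s \<in> regular_elements R" and t: "t \<in> regular_elements R" for c s t
  proof -
    have "c \<in> carrier R \<and> c \<otimes> t \<in> J \<cdot> ?K (s \<otimes> t)"
      using c
    proof induct
      case (prod j a)
      then have "j \<in> carrier R" "a \<in> carrier R" "t \<in> carrier R"
        using ideal.Icarr[OF J] t by (auto simp: regular_elements_closed)
      moreover have "j \<otimes> (a \<otimes> t) \<in> J \<cdot> ?K (s \<otimes> t)"
        by (rule ideal_prod.prod[OF prod(1) K_mult[OF prod(2) s t]])
      ultimately show ?case by (simp add: m_assoc)
    next
      case (sum c d)
      then show ?case using t by (simp add: l_distr regular_elements_closed ideal_prod.sum)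
    qed
    then show ?thesis by blast
  qed
  from sum obtain s c t d where
    h: "s \<in> regular_elements R" "c \<in> J \<cdot> ?K s" "x = frac_class R c s"
      "t \<in> regular_elements R" "d \<in> J \<cdot> ?K t" "y = frac_class R d t"
    by blast
  have cl: "c \<in> carrier R" "d \<in> carrier R"
    using h KI by (auto intro: ideal.Icarr)
  have "d \<otimes> s \<in> J \<cdot> ?K (s \<otimes> t)"
    using JK_mult[OF h(5) h(4) h(1)] h by (simp add: m_comm regular_elements_closed)
  then have "c \<otimes> t \<oplus> d \<otimes> s \<in> J \<cdot> ?K (s \<otimes> t)"
    using JK_mult[OF h(2) h(1) h(4)] by (rule ideal_prod.sum[rotated])
  moreover have "x \<oplus>\<^bsub>total_quotient_ring R\<^esub> y = frac_class R (c \<otimes> t \<oplus> d \<otimes> s) (s \<otimes> t)"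
    using h cl by (simp add: total_quotient_ring_add)
  ultimately show ?case using regular_elements_mult[OF h(1) h(4)] by blast
qed

text \<open>The single element 1 of JJ' determines the denominator: write 1 = c/s with c in JK,
  where K consists of the numerators of J' over \<open>s\<close>. Then c = s, so sR is contained in
  JK. Conversely j(a/s) lies in JJ' = R, which says that ja is a multiple of
  \<open>s\<close>.\<close>

lemma invertible_ideal_imp_principal_product:
  assumes "invertible_ideal J R"
  shows "\<exists>K s. ideal K R \<and> s \<in> regular_elements R \<and> J \<cdot> K = PIdl s"
proof -
  let ?T = "total_quotient_ring R"
  from assms obtain J' where J: "ideal J R" and J': "submodule J' R ?T"
    and eq: "(to_total R ` J) \<cdot>\<^bsub>?T\<^esub> J' = to_total R ` carrier R"
    unfolding invertible_ideal_def by blast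
  have "to_total R \<one> \<in> (to_total R ` J) \<cdot>\<^bsub>?T\<^esub> J'" unfolding eq by simp
  then obtain s c where s: "s \<in> regular_elements R"
    and c: "c \<in> J \<cdot> {a \<in> carrier R. frac_class R a s \<in> J'}" (is "_ \<in> J \<cdot> ?K")
    and eq1: "to_total R \<one> = frac_class R c s"
    using ideal_prod_common_denominator[OF J J'] by blast
  have K: "ideal ?K R" by (rule numerators_ideal[OF J' s])
  have JK: "ideal (J \<cdot> ?K) R" by (rule ideal_prod_is_ideal[OF J K])
  have sc: "s \<in> carrier R" using s by (rule regular_elements_closed)
  have cc: "c \<in> carrier R" using c by (rule ideal.Icarr[OF JK])
  have "c = s"
    using eq1 s sc cc by (simp add: to_total_def frac_eq_iff regular_elements_one)
  with c have "PIdl s \<subseteq> J \<cdot> ?K" by (intro cgenideal_minimal[OF JK]) simp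
  moreover have "J \<cdot> ?K \<subseteq> PIdl s"
  proof (rule ideal_prod_least[OF cgenideal_ideal[OF sc]])
    fix j a assume j: "j \<in> J" and a: "a \<in> ?K"
    have jc: "j \<in> carrier R" by (rule ideal.Icarr[OF J j])
    have "frac_class R (j \<otimes> a) s = to_total R j \<otimes>\<^bsub>?T\<^esub> frac_class R a s"
      using jc a s by (simp add: to_total_def total_quotient_ring_mult regular_elements_one sc)
    also have "\<dots> \<in> to_total R ` carrier R"
      unfolding eq[symmetric] using j a by (intro ideal_prod.prod) auto
    finally obtain b where b: "b \<in> carrier R" "frac_class R (j \<otimes> a) s = to_total R b" by blast
    then have "j \<otimes> a = b \<otimes> s"
      using jc a s by (simp add: to_total_def frac_eq_iff regular_elements_one)
    then show "j \<otimes> a \<in> PIdl s" using b by (auto simp: cgenideal_def)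
  qed
  ultimately show ?thesis using K s by blast
qed

text \<open>The inverse is J' = (1/s)K, since JJ' = (1/s)JK = (1/s)sR = R.\<close>

lemma principal_product_imp_invertible_ideal:
  assumes J: "ideal J R" and K: "ideal K R" and s: "s \<in> regular_elements R" and JK: "J \<cdot> K = PIdl s"
  shows "invertible_ideal J R"
proof -
  let ?T = "total_quotient_ring R"
  define J' where "J' = {frac_class R k s | k. k \<in> K}"
  interpret TC: cring ?T by (rule total_quotient_ring_cring)
  interpret T: module R ?T
    using total_quotient_ring_algebra by (simp add: algebra_def)
  interpret K: ideal K R by (rule K)
  interpret th: ring_hom_ring R ?T "to_total R"
    by (rule ring_hom_ringI2[OF ring_axioms TC.ring_axioms to_total_hom])
  have sc: "s \<in> carrier R" using s by (rule regular_elements_closed)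
  have frac_add: "frac_class R a s \<oplus>\<^bsub>?T\<^esub> frac_class R b s = frac_class R (a \<oplus> b) s"
    if ab: "a \<in> carrier R" "b \<in> carrier R" for a b
  proof -
    have "(a \<otimes> s \<oplus> b \<otimes> s) \<otimes> s = (a \<oplus> b) \<otimes> (s \<otimes> s)"
      using sc ab by (simp add: l_distr m_assoc)
    then show ?thesis
      using s sc ab by (simp add: total_quotient_ring_add frac_eq_iff regular_elements_mult)
  qed
  have frac_zero: "frac_class R \<zero> s = \<zero>\<^bsub>?T\<^esub>"
    using s sc by (simp add: total_quotient_ring_zero frac_eq_iff regular_elements_one)
  have smult: "c \<odot>\<^bsub>?T\<^esub> u \<in> J'" if "c \<in> carrier R" "u \<in> J'" for c u
    using that s by (auto simp: J'_def total_quotient_ring_smult K.Icarr intro: K.I_l_closed)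
  have J'c: "J' \<subseteq> carrier ?T" using s by (auto simp: J'_def K.Icarr intro: frac_closed)
  have sub: "submodule J' R ?T"
  proof (rule T.submoduleI[OF J'c])
    show "\<zero>\<^bsub>?T\<^esub> \<in> J'" using K.zero_closed frac_zero by (force simp: J'_def)
    fix u v assume u: "u \<in> J'"
    \<comment> \<open>Negation is scalar multiplication by \<open>\<ominus> \<one>\<close>, so
      closure under scalars already covers it.\<close>
    then have "\<ominus>\<^bsub>?T\<^esub> u = (\<ominus> \<one>) \<odot>\<^bsub>?T\<^esub> u" using J'c by (simp add: T.smult_l_minus subsetD)
    then show "\<ominus>\<^bsub>?T\<^esub> u \<in> J'" using smult[OF _ u, of "\<ominus> \<one>"] by simp
    assume "v \<in> J'"
    with u obtain a b where "a \<in> K" "b \<in> K" "u = frac_class R a s" "v = frac_class R b s"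
      unfolding J'_def by blast
    then show "u \<oplus>\<^bsub>?T\<^esub> v \<in> J'"
      using frac_add K.a_closed by (auto simp: J'_def K.Icarr)
  qed (rule smult)
  have "(to_total R ` J) \<cdot>\<^bsub>?T\<^esub> J' = to_total R ` carrier R"
  proof
    have "x \<in> to_total R ` carrier R" if "x \<in> (to_total R ` J) \<cdot>\<^bsub>?T\<^esub> J'" for x
      using that
    proof induct
      case (prod i u)
      then obtain j k where jk: "j \<in> J" "i = to_total R j" "k \<in> K" "u = frac_class R k s"
        unfolding J'_def by blast
      then have "j \<otimes> k \<in> PIdl s" unfolding JK[symmetric] by (intro ideal_prod.prod)
      then obtain b where b: "b \<in> carrier R" "j \<otimes> k = b \<otimes> s" unfolding cgenideal_def by blast
      have "i \<otimes>\<^bsub>?T\<^esub> u = frac_class R (j \<otimes> k) s"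
        using jk s sc by (simp add: to_total_def total_quotient_ring_mult regular_elements_one
            K.Icarr ideal.Icarr[OF J])
      also have "\<dots> = to_total R b"
        using b s sc by (simp add: to_total_def frac_eq_iff regular_elements_one)
      finally show ?case using b by blast
    next
      case (sum x y)
      then show ?case by (auto simp flip: th.hom_add)
    qed
    then show "(to_total R ` J) \<cdot>\<^bsub>?T\<^esub> J' \<subseteq> to_total R ` carrier R" by blast
  next
    \<comment> \<open>Division by \<open>s\<close> maps JK into JJ'. Every x in R is reached in this
      way, being (xs)/s with xs in sR = JK.\<close>
    have frac: "c \<in> carrier R \<and> frac_class R c s \<in> (to_total R ` J) \<cdot>\<^bsub>?T\<^esub> J'" if "c \<in> J \<cdot> K" for c
      using that
    proof induct
      case (prod j k)
      then have "to_total R j \<otimes>\<^bsub>?T\<^esub> frac_class R k s \<in> (to_total R ` J) \<cdot>\<^bsub>?T\<^esub> J'"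
        by (intro ideal_prod.prod) (auto simp: J'_def)
      then show ?case
        using prod s sc by (simp add: to_total_def total_quotient_ring_mult regular_elements_one
            K.Icarr ideal.Icarr[OF J])
    next
      case (sum c d)
      then show ?case by (simp flip: frac_add add: ideal_prod.sum)
    qed
    show "to_total R ` carrier R \<subseteq> (to_total R ` J) \<cdot>\<^bsub>?T\<^esub> J'"
    proof (rule image_subsetI)
      fix x assume x: "x \<in> carrier R"
      then have "x \<otimes> s \<in> J \<cdot> K" unfolding JK by (auto simp: cgenideal_def)
      moreover have "frac_class R (x \<otimes> s) s = to_total R x"
        using x s sc by (simp add: to_total_def frac_eq_iff regular_elements_one)
      ultimately show "to_total R x \<in> (to_total R ` J) \<cdot>\<^bsub>?T\<^esub> J'" using frac by metis
    qed
  qed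
  then show ?thesis unfolding invertible_ideal_def using J sub by blast
qed

lemma invertible_ideal_iff:
  "invertible_ideal J R \<longleftrightarrow>
    ideal J R \<and> (\<exists>K s. ideal K R \<and> s \<in> regular_elements R \<and> J \<cdot> K = PIdl s)"
  using invertible_ideal_imp_principal_product principal_product_imp_invertible_ideal
  unfolding invertible_ideal_def by blast

text \<open>This gives the unit ideal a factorization with no radical factor at all.\<close>

lemma invertible_ideal_carrier: "invertible_ideal (carrier R) R"
proof (rule principal_product_imp_invertible_ideal)
  show "carrier R \<cdot> carrier R = PIdl \<one>"
    by (force simp: ideal_prod_one oneideal cgenideal_def)
qed (auto simp: oneideal regular_elements_one)

end

section \<open>Products of two rings\<close>

text \<open>The factorization condition of an ISP-ring. Unlike \<^const>\<open>ISP_ring\<close> it is satisfied by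
  the zero ring, so that the induction over the list of factors can start at the empty product.\<close>

definition factors_regular_ideals :: "('a, 'm) ring_scheme \<Rightarrow> bool" where
  "factors_regular_ideals A \<longleftrightarrow>
     (\<forall>I. proper_ideal I A \<and> regular_ideal I A \<longrightarrow>
        (\<exists>J Hs. invertible_ideal J A \<and> length Hs \<ge> 1 \<and>
                (\<forall>H \<in> set Hs. proper_radical_ideal H A) \<and>
                I = foldl (ideal_prod A) J Hs))"

text \<open>A proper ideal of a product ring may have a component that is a whole ring. The
  factorization is therefore extended to the unit ideal, at the price of a possibly empty list of
  radical factors.\<close>

lemma (in cring) factors_regular_idealsE:
  assumes "factors_regular_ideals R" and "regular_ideal I R"
  obtains J Hs where "invertible_ideal J R" and "\<forall>H \<in> set Hs. proper_radical_ideal H R"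
    and "I = foldl (ideal_prod R) J Hs" and "I \<noteq> carrier R \<Longrightarrow> Hs \<noteq> []"
proof (cases "I = carrier R")
  case True
  then show ?thesis using that[of "carrier R" "[]"] invertible_ideal_carrier by simp
next
  case False
  then have "proper_ideal I R" using assms(2) by (simp add: proper_ideal_def regular_ideal_def)
  then obtain J Hs where "invertible_ideal J R" "length Hs \<ge> 1"
    "\<forall>H \<in> set Hs. proper_radical_ideal H R" "I = foldl (ideal_prod R) J Hs"
    using assms unfolding factors_regular_ideals_def by blast
  then show ?thesis by (intro that[of J Hs]) auto
qed

lemma proper_radical_ideal_ideal: "proper_radical_ideal H A \<Longrightarrow> ideal H A"
  by (simp add: proper_radical_ideal_def proper_ideal_def)

text \<open>The product is described by its two projections instead of by pairs. The description is
  symmetric in the two factors and also fits lists, with \<open>hd\<close> and \<open>tl\<close> as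
  projections.\<close>

locale ring_product = p: ring_hom_cring B R p + q: ring_hom_cring B S q
  for B :: "('a, 'k) ring_scheme" and R :: "('b, 'l) ring_scheme" and S :: "('c, 'm) ring_scheme"
    and p q +
  assumes bij: "bij_betw (\<lambda>b. (p b, q b)) (carrier B) (carrier R \<times> carrier S)"
begin

text \<open>Statements are proved for \<open>p\<close> only; this symmetry yields them for
  \<open>q\<close>.\<close>

lemma swap: "ring_product B S R q p"
proof (intro ring_product.intro ring_product_axioms.intro)
  have "bij_betw prod.swap (carrier R \<times> carrier S) (carrier S \<times> carrier R)"
    by (auto simp: bij_betw_def)
  from bij_betw_trans[OF bij this]
  show "bij_betw (\<lambda>b. (q b, p b)) (carrier B) (carrier S \<times> carrier R)"
    by (simp add: comp_def)
qed (rule p.ring_hom_cring_axioms q.ring_hom_cring_axioms)+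

section \<open>Elements and ideals of the product\<close>

lemma ex_elem:
  assumes "r \<in> carrier R" "s \<in> carrier S"
  obtains b where "b \<in> carrier B" "p b = r" "q b = s"
proof -
  have "(r, s) \<in> (\<lambda>b. (p b, q b)) ` carrier B"
    using bij assms by (simp add: bij_betw_def)
  then show ?thesis using that by blast
qed

lemma elem_eqI:
  "b \<in> carrier B \<Longrightarrow> c \<in> carrier B \<Longrightarrow> p b = p c \<Longrightarrow> q b = q c \<Longrightarrow> b = c"
  using bij by (auto simp: bij_betw_def inj_on_def)

lemma p_surj: "p ` carrier B = carrier R"
proof
  show "carrier R \<subseteq> p ` carrier B"
  proof
    fix r assume "r \<in> carrier R"
    then obtain b where "b \<in> carrier B" "p b = r" using ex_elem[of r "\<zero>\<^bsub>S\<^esub>"] by blast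
    then show "r \<in> p ` carrier B" by blast
  qed
qed auto

text \<open>Choose x and y in \<open>I\<close> that agree with \<open>b\<close> in the first and in
  the second component. With the idempotents e = (1, 0) and f = (0, 1) one has b = ex + fy. Hence an
  ideal of \<open>B\<close> is determined by its two projections.\<close>

lemma ideal_memI:
  assumes I: "ideal I B" and b: "b \<in> carrier B" and "p b \<in> p ` I" "q b \<in> q ` I"
  shows "b \<in> I"
proof -
  interpret I: ideal I B by (rule I)
  obtain x y where x: "x \<in> I" "p b = p x" and y: "y \<in> I" "q b = q y" using assms(3,4) by blast
  obtain e where e: "e \<in> carrier B" "p e = \<one>\<^bsub>R\<^esub>" "q e = \<zero>\<^bsub>S\<^esub>"
    using ex_elem[OF p.S.one_closed q.S.zero_closed] by blast
  obtain f where f: "f \<in> carrier B" "p f = \<zero>\<^bsub>R\<^esub>" "q f = \<one>\<^bsub>S\<^esub>"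
    using ex_elem[OF p.S.zero_closed q.S.one_closed] by blast
  have "b = e \<otimes>\<^bsub>B\<^esub> x \<oplus>\<^bsub>B\<^esub> f \<otimes>\<^bsub>B\<^esub> y"
    by (rule elem_eqI) (use b x y e f in \<open>auto simp: I.Icarr\<close>)
  also have "\<dots> \<in> I" using x y e f by (auto intro: I.I_l_closed)
  finally show ?thesis .
qed

lemma ideal_eqI:
  assumes "ideal I B" "ideal K B" "p ` I = p ` K" "q ` I = q ` K"
  shows "I = K"
proof
  show "I \<subseteq> K" using assms by (auto intro!: ideal_memI[of K] ideal.Icarr[of I])
  show "K \<subseteq> I" using assms by (auto intro!: ideal_memI[of I] ideal.Icarr[of K])
qed

lemma p_ideal:
  assumes I: "ideal I B"
  shows "ideal (p ` I) R"
proof -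
  interpret I: ideal I B by (rule I)
  show ?thesis
  proof (rule p.S.ideal_cringI)
    show "\<zero>\<^bsub>R\<^esub> \<in> p ` I" using I.zero_closed p.hom_zero by (metis imageI)
    show "a \<oplus>\<^bsub>R\<^esub> b \<in> p ` I" if "a \<in> p ` I" "b \<in> p ` I" for a b
      using that by (auto simp: I.Icarr simp flip: p.hom_add)
    show "x \<otimes>\<^bsub>R\<^esub> a \<in> p ` I" if "a \<in> p ` I" "x \<in> carrier R" for a x
      using that unfolding p_surj[symmetric]
      by (auto simp: I.Icarr I.I_l_closed simp flip: p.hom_mult)
  qed (auto simp: I.Icarr)
qed

text \<open>The ideal I \<times> K, taken as an intersection of preimages because the elements of
  \<open>B\<close> need not be pairs.\<close>

definition prod_ideal :: "'b set \<Rightarrow> 'c set \<Rightarrow> 'a set" where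
  "prod_ideal I K = {b \<in> carrier B. p b \<in> I \<and> q b \<in> K}"

lemma prod_ideal_swap: "ring_product.prod_ideal B q p K I = prod_ideal I K"
  by (auto simp: ring_product.prod_ideal_def[OF swap] prod_ideal_def)

lemma prod_ideal_ideal:
  assumes I: "ideal I R" and K: "ideal K S"
  shows "ideal (prod_ideal I K) B"
proof -
  have "prod_ideal I K = {b \<in> carrier B. p b \<in> I} \<inter> {b \<in> carrier B. q b \<in> K}"
    by (auto simp: prod_ideal_def)
  then show ?thesis
    by (simp add: p.R.i_intersect p.ring.ideal_vimage[OF I] q.ring.ideal_vimage[OF K])
qed

lemma p_prod_ideal:
  assumes I: "ideal I R" and K: "ideal K S"
  shows "p ` prod_ideal I K = I"
proof
  show "I \<subseteq> p ` prod_ideal I K"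
  proof
    fix r assume r: "r \<in> I"
    \<comment> \<open>Zero lies in every ideal of S, so (r, 0) is a lift of \<open>r\<close> inside
      I \<times> K.\<close>
    have "\<zero>\<^bsub>S\<^esub> \<in> K" using K by (simp add: additive_subgroup.zero_closed ideal.axioms(1))
    moreover obtain b where "b \<in> carrier B" "p b = r" "q b = \<zero>\<^bsub>S\<^esub>"
      by (rule ex_elem[of r "\<zero>\<^bsub>S\<^esub>"]) (use r ideal.Icarr[OF I] in auto)
    ultimately show "r \<in> p ` prod_ideal I K" using r by (auto simp: prod_ideal_def)
  qed
qed (auto simp: prod_ideal_def)

lemma q_prod_ideal: "ideal I R \<Longrightarrow> ideal K S \<Longrightarrow> q ` prod_ideal I K = K"
  using ring_product.p_prod_ideal[OF swap] by (simp add: prod_ideal_swap)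

section \<open>Regularity and invertibility in the product\<close>

lemma p_regular:
  assumes b: "b \<in> regular_elements B"
  shows "p b \<in> regular_elements R"
proof -
  have bc: "b \<in> carrier B" using b by (simp add: regular_elements_def)
  have "r = \<zero>\<^bsub>R\<^esub>" if r: "r \<in> carrier R" "p b \<otimes>\<^bsub>R\<^esub> r = \<zero>\<^bsub>R\<^esub>" for r
  proof -
    \<comment> \<open>The lift (r, 0) is annihilated by \<open>b\<close> in both components, so
      regularity of \<open>b\<close> makes it zero.\<close>
    obtain c where c: "c \<in> carrier B" "p c = r" "q c = \<zero>\<^bsub>S\<^esub>"
      using ex_elem[OF r(1) q.S.zero_closed] by blast
    then have "b \<otimes>\<^bsub>B\<^esub> c = \<zero>\<^bsub>B\<^esub>"
      using bc r by (intro elem_eqI) auto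
    then have "c = \<zero>\<^bsub>B\<^esub>" using b c by (auto simp: regular_elements_def)
    then show ?thesis using c by auto
  qed
  then show ?thesis using bc by (auto simp: regular_elements_def)
qed

lemma regularI:
  assumes b: "b \<in> carrier B" "p b \<in> regular_elements R" "q b \<in> regular_elements S"
  shows "b \<in> regular_elements B"
proof -
  have "c = \<zero>\<^bsub>B\<^esub>" if c: "c \<in> carrier B" "b \<otimes>\<^bsub>B\<^esub> c = \<zero>\<^bsub>B\<^esub>" for c
  proof (rule elem_eqI)
    have "p b \<otimes>\<^bsub>R\<^esub> p c = \<zero>\<^bsub>R\<^esub>" "q b \<otimes>\<^bsub>S\<^esub> q c = \<zero>\<^bsub>S\<^esub>"
      using b c by (simp_all flip: p.hom_mult q.hom_mult)
    then have "p c = \<zero>\<^bsub>R\<^esub>" "q c = \<zero>\<^bsub>S\<^esub>"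
      using b(2,3) p.hom_closed[OF c(1)] q.hom_closed[OF c(1)]
      unfolding regular_elements_def by blast+
    then show "p c = p \<zero>\<^bsub>B\<^esub>" "q c = q \<zero>\<^bsub>B\<^esub>" by simp_all
  qed (simp_all add: c(1))
  then show ?thesis using b by (auto simp: regular_elements_def)
qed

lemma p_regular_ideal:
  assumes "regular_ideal I B"
  shows "regular_ideal (p ` I) R"
  using assms p_ideal p_regular unfolding regular_ideal_def by blast

lemma regular_prod_ideal:
  assumes "regular_ideal I R" "regular_ideal K S"
  shows "regular_ideal (prod_ideal I K) B"
proof -
  obtain r s where rs: "r \<in> I" "r \<in> regular_elements R" "s \<in> K" "s \<in> regular_elements S"
    using assms unfolding regular_ideal_def by blast
  then obtain b where "b \<in> carrier B" "p b = r" "q b = s"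
    using ex_elem[of r s] by (auto simp: regular_elements_def)
  then have "b \<in> prod_ideal I K \<inter> regular_elements B"
    using rs regularI by (auto simp: prod_ideal_def)
  then show ?thesis
    using assms prod_ideal_ideal unfolding regular_ideal_def by blast
qed

text \<open>The equation JK = sB is mapped by \<open>p\<close> to an equation of the same kind in R;
  surjectivity of \<open>p\<close> keeps the right-hand side principal.\<close>

lemma p_invertible_ideal:
  assumes "invertible_ideal J B"
  shows "invertible_ideal (p ` J) R"
proof -
  obtain K s where J: "ideal J B" and K: "ideal K B" and s: "s \<in> regular_elements B"
    and JK: "J \<cdot>\<^bsub>B\<^esub> K = PIdl\<^bsub>B\<^esub> s"
    using assms unfolding p.R.invertible_ideal_iff by blast
  have "s \<in> carrier B" using s by (rule p.R.regular_elements_closed)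
  then have "p ` J \<cdot>\<^bsub>R\<^esub> p ` K = PIdl\<^bsub>R\<^esub> (p s)"
    using J K by (simp add: p.ring.img_cgenideal[OF p_surj, symmetric] JK[symmetric]
        p.ring.img_ideal_prod ideal.Icarr subsetI)
  then show ?thesis
    unfolding p.S.invertible_ideal_iff using p_ideal J K p_regular s by blast
qed

lemma invertible_prod_ideal:
  assumes "invertible_ideal I R" "invertible_ideal K S"
  shows "invertible_ideal (prod_ideal I K) B"
proof -
  interpret sw: ring_product B S R q p by (rule swap)
  obtain I' s where I: "ideal I R" and I': "ideal I' R" and s: "s \<in> regular_elements R"
    and II': "I \<cdot>\<^bsub>R\<^esub> I' = PIdl\<^bsub>R\<^esub> s"
    using assms unfolding p.S.invertible_ideal_iff by blast
  obtain K' t where K: "ideal K S" and K': "ideal K' S" and t: "t \<in> regular_elements S"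
    and KK': "K \<cdot>\<^bsub>S\<^esub> K' = PIdl\<^bsub>S\<^esub> t"
    using assms unfolding q.S.invertible_ideal_iff by blast
  \<comment> \<open>The generator is (s, t) and the cofactor is I' \<times> K'. Under the two
    projections the required identity becomes II' = sR and KK' = tS.\<close>
  obtain b where b: "b \<in> carrier B" "p b = s" "q b = t"
    using ex_elem[of s t] s t by (auto simp: regular_elements_def)
  have id: "ideal (prod_ideal I K) B" "ideal (prod_ideal I' K') B"
    using I I' K K' by (auto intro: prod_ideal_ideal)
  have "prod_ideal I K \<cdot>\<^bsub>B\<^esub> prod_ideal I' K' = PIdl\<^bsub>B\<^esub> b"
  proof (rule ideal_eqI)
    have sub: "prod_ideal I K \<subseteq> carrier B" "prod_ideal I' K' \<subseteq> carrier B"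
      by (auto simp: prod_ideal_def)
    show "p ` (prod_ideal I K \<cdot>\<^bsub>B\<^esub> prod_ideal I' K') = p ` (PIdl\<^bsub>B\<^esub> b)"
      using I I' K K' b II' sub
      by (simp add: p.ring.img_cgenideal[OF p_surj] p.ring.img_ideal_prod p_prod_ideal)
    show "q ` (prod_ideal I K \<cdot>\<^bsub>B\<^esub> prod_ideal I' K') = q ` (PIdl\<^bsub>B\<^esub> b)"
      using I I' K K' b KK' sub
      by (simp add: q.ring.img_cgenideal[OF sw.p_surj] q.ring.img_ideal_prod q_prod_ideal)
  qed (use id b in \<open>auto intro: p.R.ideal_prod_is_ideal p.R.cgenideal_ideal\<close>)
  moreover have "b \<in> regular_elements B" using b s t by (intro regularI) auto
  ultimately show ?thesis unfolding p.R.invertible_ideal_iff using id by blast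
qed

section \<open>Radical ideals of the product\<close>

lemma p_radical:
  assumes H: "ideal H B" and rad: "radical B H = H"
  shows "radical R (p ` H) = p ` H"
proof
  interpret sw: ring_product B S R q p by (rule swap)
  show "p ` H \<subseteq> radical R (p ` H)"
    using ideal.Icarr[OF p_ideal[OF H]] by (auto simp: radical_def intro: exI[of _ "1::nat"])
  show "radical R (p ` H) \<subseteq> p ` H"
  proof
    fix r assume "r \<in> radical R (p ` H)"
    then obtain k :: nat where r: "r \<in> carrier R" and k: "k \<ge> 1" "r [^]\<^bsub>R\<^esub> k \<in> p ` H"
      by (auto simp: radical_def)
    \<comment> \<open>The k-th power of the lift (r, 0) is the pair of the k-th power of r and 0. It
      lies in \<open>H\<close>, so the radical ideal \<open>H\<close> contains the lift
      itself.\<close>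
    obtain b where b: "b \<in> carrier B" "p b = r" "q b = \<zero>\<^bsub>S\<^esub>"
      using ex_elem[OF r q.S.zero_closed] by blast
    have q0: "\<zero>\<^bsub>S\<^esub> \<in> q ` H"
      using sw.p_ideal[OF H] by (simp add: additive_subgroup.zero_closed ideal.axioms(1))
    \<comment> \<open>Here \<open>k \<ge> 1\<close> matters: the zeroth power of zero would be
      one.\<close>
    have "p (b [^]\<^bsub>B\<^esub> k) = r [^]\<^bsub>R\<^esub> k" "q (b [^]\<^bsub>B\<^esub> k) = \<zero>\<^bsub>S\<^esub>"
      using b k(1) by (simp_all add: p.ring.hom_nat_pow q.ring.hom_nat_pow q.S.nat_pow_zero)
    then have "b [^]\<^bsub>B\<^esub> k \<in> H"
      using b(1) k(2) q0 by (intro ideal_memI[OF H]) simp_all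
    then have "b \<in> radical B H" using b(1) k(1) unfolding radical_def by blast
    then have "b \<in> H" by (simp only: rad)
    then show "r \<in> p ` H" using b by blast
  qed
qed

text \<open>Membership in H \<times> S is tested by \<open>p\<close> alone, so both radicality and
  properness are inherited from \<open>H\<close>.\<close>

lemma proper_radical_prod_ideal:
  assumes "proper_radical_ideal H R"
  shows "proper_radical_ideal (prod_ideal H (carrier S)) B"
proof -
  have H: "ideal H R" "H \<noteq> carrier R" "radical R H = H"
    using assms by (auto simp: proper_radical_ideal_def proper_ideal_def)
  have id: "ideal (prod_ideal H (carrier S)) B"
    using H by (intro prod_ideal_ideal q.S.oneideal)
  have "prod_ideal H (carrier S) \<noteq> carrier B"
    using p_prod_ideal[OF H(1) q.S.oneideal] p_surj H(2) by auto
  moreover have "radical B (prod_ideal H (carrier S)) = prod_ideal H (carrier S)"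
  proof
    show "radical B (prod_ideal H (carrier S)) \<subseteq> prod_ideal H (carrier S)"
    proof
      fix x assume "x \<in> radical B (prod_ideal H (carrier S))"
      then obtain k :: nat where "x \<in> carrier B" "k \<ge> 1" "p x [^]\<^bsub>R\<^esub> k \<in> H"
        by (auto simp: radical_def prod_ideal_def p.ring.hom_nat_pow)
      then have "p x \<in> radical R H" by (auto simp: radical_def)
      then show "x \<in> prod_ideal H (carrier S)"
        using H(3) \<open>x \<in> carrier B\<close> by (auto simp: prod_ideal_def)
    qed
    show "prod_ideal H (carrier S) \<subseteq> radical B (prod_ideal H (carrier S))"
      using ideal.Icarr[OF id] by (auto simp: radical_def intro: exI[of _ "1::nat"])
  qed
  ultimately show ?thesis using id by (simp add: proper_radical_ideal_def proper_ideal_def)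
qed

section \<open>Transfer of factorizations\<close>

lemma factors_regular_ideals_left:
  assumes B: "factors_regular_ideals B"
  shows "factors_regular_ideals R"
  unfolding factors_regular_ideals_def
proof (intro allI impI, elim conjE)
  fix I assume "proper_ideal I R" and reg: "regular_ideal I R"
  then have I: "ideal I R" "I \<noteq> carrier R" by (auto simp: proper_ideal_def)
  \<comment> \<open>The unit ideal in the second component keeps the ideal regular and will fill the
    second component of each factor.\<close>
  let ?I = "prod_ideal I (carrier S)"
  have pI: "p ` ?I = I" and qI: "q ` ?I = carrier S"
    using I p_prod_ideal q_prod_ideal q.S.oneideal by auto
  have "regular_ideal (carrier S) S"
    using q.S.oneideal q.S.regular_elements_one by (auto simp: regular_ideal_def)
  then have "regular_ideal ?I B" using reg by (rule regular_prod_ideal[rotated])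
  moreover have "proper_ideal ?I B"
    using prod_ideal_ideal[OF I(1) q.S.oneideal] pI p_surj I(2) by (auto simp: proper_ideal_def)
  ultimately obtain J Hs where J: "invertible_ideal J B" and len: "length Hs \<ge> 1"
    and Hs: "\<forall>H \<in> set Hs. proper_radical_ideal H B" and eq: "?I = foldl (ideal_prod B) J Hs"
    using B unfolding factors_regular_ideals_def by blast
  have J': "ideal J B" using J by (simp add: invertible_ideal_def)
  have Hs': "\<forall>H \<in> set Hs. ideal H B" using Hs proper_radical_ideal_ideal by blast
  have "proper_radical_ideal (p ` H) R" if H: "H \<in> set Hs" for H
  proof -
    have H': "ideal H B" "H \<noteq> carrier B" "radical B H = H"
      using Hs H by (auto simp: proper_radical_ideal_def proper_ideal_def)
    \<comment> \<open>The factor \<open>H\<close> contains the product, so its second projection is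
      S. As \<open>H\<close> is proper, its first projection cannot also be the whole ring.\<close>
    have "?I \<subseteq> H" using p.R.foldl_ideal_prod_subset[OF J' Hs'] H eq by simp
    then have "q ` ?I \<subseteq> q ` H" by (rule image_mono)
    then have qH: "q ` H = q ` carrier B"
      using qI ideal.Icarr[OF H'(1)] by auto
    have "p ` H \<noteq> carrier R"
      using ideal_eqI[OF H'(1) p.R.oneideal _ qH] H'(2) p_surj by auto
    then show ?thesis
      using p_ideal p_radical H' by (simp add: proper_radical_ideal_def proper_ideal_def)
  qed
  moreover have "I = foldl (ideal_prod R) (p ` J) (map ((`) p) Hs)"
    using pI eq p.ring.img_foldl_ideal_prod[OF J' Hs'] by simp
  ultimately show "\<exists>J Hs. invertible_ideal J R \<and> length Hs \<ge> 1 \<and>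
      (\<forall>H \<in> set Hs. proper_radical_ideal H R) \<and> I = foldl (ideal_prod R) J Hs"
    using p_invertible_ideal[OF J] len
    by (intro exI[of _ "p ` J"] exI[of _ "map ((`) p) Hs"]) auto
qed

lemma factors_regular_ideals_prod:
  assumes R: "factors_regular_ideals R" and S: "factors_regular_ideals S"
  shows "factors_regular_ideals B"
  unfolding factors_regular_ideals_def
proof (intro allI impI, elim conjE)
  interpret sw: ring_product B S R q p by (rule swap)
  fix I assume "proper_ideal I B" and reg: "regular_ideal I B"
  then have I: "ideal I B" "I \<noteq> carrier B" by (auto simp: proper_ideal_def)
  \<comment> \<open>One of the two projections may be a whole ring, so either list may be
    empty.\<close>
  obtain J1 Hs1 where 1: "invertible_ideal J1 R" "\<forall>H \<in> set Hs1. proper_radical_ideal H R"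
    "p ` I = foldl (ideal_prod R) J1 Hs1" "p ` I \<noteq> carrier R \<Longrightarrow> Hs1 \<noteq> []"
    using p.S.factors_regular_idealsE[OF R p_regular_ideal[OF reg]] by metis
  obtain J2 Hs2 where 2: "invertible_ideal J2 S" "\<forall>H \<in> set Hs2. proper_radical_ideal H S"
    "q ` I = foldl (ideal_prod S) J2 Hs2" "q ` I \<noteq> carrier S \<Longrightarrow> Hs2 \<noteq> []"
    using q.S.factors_regular_idealsE[OF S sw.p_regular_ideal[OF reg]] by metis
  define J where "J = prod_ideal J1 J2"
  \<comment> \<open>Each radical factor is completed by the unit ideal of the other ring. A
    projection therefore returns the factor or the unit ideal.\<close>
  define Hs where "Hs = map (\<lambda>H. prod_ideal H (carrier S)) Hs1 @ map (prod_ideal (carrier R)) Hs2"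
  have J12: "ideal J1 R" "ideal J2 S" using 1 2 by (auto simp: invertible_ideal_def)
  have H1: "\<forall>H \<in> set Hs1. ideal H R" and H2: "\<forall>H \<in> set Hs2. ideal H S"
    using 1 2 proper_radical_ideal_ideal by blast+
  have J: "invertible_ideal J B" unfolding J_def by (rule invertible_prod_ideal) fact+
  then have J': "ideal J B" by (simp add: invertible_ideal_def)
  have Hs: "\<forall>H \<in> set Hs. proper_radical_ideal H B"
    using 1(2) 2(2) proper_radical_prod_ideal sw.proper_radical_prod_ideal
    by (auto simp: Hs_def prod_ideal_swap)
  then have Hs': "\<forall>H \<in> set Hs. ideal H B" using proper_radical_ideal_ideal by blast
  have "p ` J = J1" "q ` J = J2" unfolding J_def using J12 by (rule p_prod_ideal q_prod_ideal)+
  moreover have "map ((`) p) Hs = Hs1 @ replicate (length Hs2) (carrier R)"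
    using H1 H2
    by (auto simp: Hs_def p_prod_ideal p.S.oneideal q.S.oneideal map_replicate_const[symmetric]
        intro!: map_idI)
  moreover have "map ((`) q) Hs = replicate (length Hs1) (carrier S) @ Hs2"
    using H1 H2
    by (auto simp: Hs_def q_prod_ideal p.S.oneideal q.S.oneideal map_replicate_const[symmetric]
        intro!: map_idI)
  \<comment> \<open>Under \<open>p\<close> the unit factors come last, so the product of
    \<open>J1\<close> and \<open>Hs1\<close> must be known to be an ideal. Under \<open>q\<close>
    they come first and are absorbed by \<open>J2\<close>.\<close>
  ultimately have pI: "p ` foldl (ideal_prod B) J Hs = p ` I"
    and qI: "q ` foldl (ideal_prod B) J Hs = q ` I"
    using 1(3) 2(3) J12 H1
    by (simp_all add: p.ring.img_foldl_ideal_prod[OF J' Hs'] q.ring.img_foldl_ideal_prod[OF J' Hs']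
        p.S.foldl_ideal_prod_one q.S.foldl_ideal_prod_one p.S.foldl_ideal_prod_ideal)
  have eq: "I = foldl (ideal_prod B) J Hs"
    using ideal_eqI[OF I(1) p.R.foldl_ideal_prod_ideal[OF J' Hs']] pI qI by simp
  \<comment> \<open>If both projections were whole rings, \<open>I\<close> would be
    \<open>B\<close>. So at least one of the two lists is nonempty.\<close>
  have "p ` I \<noteq> carrier R \<or> q ` I \<noteq> carrier S"
    using ideal_eqI[OF I(1) p.R.oneideal] I(2) p_surj sw.p_surj by auto
  then have "length Hs \<ge> 1" using 1(4) 2(4) by (auto simp: Hs_def Suc_le_eq)
  then show "\<exists>J Hs. invertible_ideal J B \<and> length Hs \<ge> 1 \<and>
      (\<forall>H \<in> set Hs. proper_radical_ideal H B) \<and> I = foldl (ideal_prod B) J Hs"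
    using J Hs eq by blast
qed

lemma factors_regular_ideals_iff:
  "factors_regular_ideals B \<longleftrightarrow> factors_regular_ideals R \<and> factors_regular_ideals S"
  using factors_regular_ideals_left ring_product.factors_regular_ideals_left[OF swap]
    factors_regular_ideals_prod by blast

end

section \<open>Products of lists of rings\<close>

text \<open>Both rules are read off from \<open>RDirProd_list_hom1\<close>, by which consing is a
  homomorphism from the binary product.\<close>

lemma RDirProd_list_Cons_simps:
  assumes "a \<in> carrier R" "as \<in> carrier (RDirProd_list Rs)"
    and "b \<in> carrier R" "bs \<in> carrier (RDirProd_list Rs)"
  shows "(a # as) \<otimes>\<^bsub>RDirProd_list (R # Rs)\<^esub> (b # bs) =
      (a \<otimes>\<^bsub>R\<^esub> b) # (as \<otimes>\<^bsub>RDirProd_list Rs\<^esub> bs)"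
    and "(a # as) \<oplus>\<^bsub>RDirProd_list (R # Rs)\<^esub> (b # bs) =
      (a \<oplus>\<^bsub>R\<^esub> b) # (as \<oplus>\<^bsub>RDirProd_list Rs\<^esub> bs)"
proof -
  have "(a, as) \<in> carrier (RDirProd R (RDirProd_list Rs))"
    "(b, bs) \<in> carrier (RDirProd R (RDirProd_list Rs))"
    using assms by (auto simp: RDirProd_carrier)
  from ring_hom_mult[OF RDirProd_list_hom1 this] ring_hom_add[OF RDirProd_list_hom1 this]
  show "(a # as) \<otimes>\<^bsub>RDirProd_list (R # Rs)\<^esub> (b # bs) =
      (a \<otimes>\<^bsub>R\<^esub> b) # (as \<otimes>\<^bsub>RDirProd_list Rs\<^esub> bs)"
    and "(a # as) \<oplus>\<^bsub>RDirProd_list (R # Rs)\<^esub> (b # bs) =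
      (a \<oplus>\<^bsub>R\<^esub> b) # (as \<oplus>\<^bsub>RDirProd_list Rs\<^esub> bs)"
    by (simp_all add: RDirProd_def DirProd_def monoid.defs)
qed

lemma RDirProd_list_Cons_one:
  "\<one>\<^bsub>RDirProd_list (R # Rs)\<^esub> = \<one>\<^bsub>R\<^esub> # \<one>\<^bsub>RDirProd_list Rs\<^esub>"
  by (simp add: RDirProd_list_one)

lemma RDirProd_list_cring:
  assumes "\<forall>R \<in> set Rs. cring R"
  shows "cring (RDirProd_list Rs)"
  using assms
proof (induct Rs)
  case Nil
  have "ring (RDirProd_list [])" by (rule RDirProd_list_is_ring) simp
  then show ?case by (intro cring.intro comm_monoid.intro comm_monoid_axioms.intro)
      (auto simp: ring.is_monoid)
next
  case (Cons R Rs)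
  have "ring (RDirProd_list (R # Rs))"
    using Cons.prems by (intro RDirProd_list_is_ring) (metis cring_def nth_mem)
  moreover have "comm_monoid (RDirProd_list (R # Rs))"
  proof (intro comm_monoid.intro comm_monoid_axioms.intro)
    interpret R: cring R using Cons.prems by simp
    interpret Rs: cring "RDirProd_list Rs" using Cons by simp
    fix x y assume "x \<in> carrier (RDirProd_list (R # Rs))" "y \<in> carrier (RDirProd_list (R # Rs))"
    then show "x \<otimes>\<^bsub>RDirProd_list (R # Rs)\<^esub> y = y \<otimes>\<^bsub>RDirProd_list (R # Rs)\<^esub> x"
      by (auto simp: RDirProd_list_carrier RDirProd_list_Cons_simps R.m_comm Rs.m_comm)
  qed (rule ring.is_monoid[OF calculation])
  ultimately show ?case by (simp add: cring_def)
qed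

text \<open>This makes the theory of two factors available as the induction step for lists.\<close>

lemma RDirProd_list_Cons_product:
  assumes R: "cring R" and Rs: "\<forall>S \<in> set Rs. cring S"
  shows "ring_product (RDirProd_list (R # Rs)) R (RDirProd_list Rs) hd tl"
proof -
  have B: "cring (RDirProd_list (R # Rs))" "cring (RDirProd_list Rs)"
    using assms RDirProd_list_cring[of "R # Rs"] RDirProd_list_cring[of Rs] by simp_all
  have "hd \<in> ring_hom (RDirProd_list (R # Rs)) R"
    by (rule ring_hom_memI)
      (auto simp: RDirProd_list_carrier RDirProd_list_Cons_simps RDirProd_list_Cons_one)
  moreover have "tl \<in> ring_hom (RDirProd_list (R # Rs)) (RDirProd_list Rs)"
    by (rule ring_hom_memI)
      (auto simp: RDirProd_list_carrier RDirProd_list_Cons_simps RDirProd_list_Cons_one)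
  moreover have "bij_betw (\<lambda>b. (hd b, tl b)) (carrier (RDirProd_list (R # Rs)))
      (carrier R \<times> carrier (RDirProd_list Rs))"
    by (rule bij_betwI[where g = "\<lambda>(a, as). a # as"]) (auto simp: RDirProd_list_carrier)
  ultimately show ?thesis
    using R B by (intro ring_product.intro ring_product_axioms.intro ring_hom_cring.intro
        ring_hom_cring_axioms.intro)
qed

lemma factors_regular_ideals_RDirProd_list:
  assumes "\<forall>R \<in> set Rs. cring R"
  shows "factors_regular_ideals (RDirProd_list Rs) \<longleftrightarrow> (\<forall>R \<in> set Rs. factors_regular_ideals R)"
  using assms
proof (induct Rs)
  case Nil
  \<comment> \<open>The empty product is the zero ring with \<open>[]\<close> as its only element.
    It has no proper ideal, so the factorization condition holds vacuously.\<close>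
  have "I = carrier (RDirProd_list [])" if "ideal I (RDirProd_list [])"
    for I :: "'a list set"
  proof -
    have "[] \<in> I"
      using additive_subgroup.zero_closed[OF ideal.axioms(1)[OF that]]
      by (simp add: RDirProd_list_zero del: RDirProd_list_nil)
    then show ?thesis using ideal.Icarr[OF that] by auto
  qed
  then show ?case
    by (auto simp: factors_regular_ideals_def proper_ideal_def simp del: RDirProd_list_nil)
next
  case (Cons R Rs)
  then interpret ring_product "RDirProd_list (R # Rs)" R "RDirProd_list Rs" hd tl
    by (intro RDirProd_list_Cons_product) auto
  show ?case using Cons factors_regular_ideals_iff by simp
qed

text \<open>One and zero already differ in the first component, which exists because the list is
  nonempty.\<close>

lemma RDirProd_list_nonzero_cring:
  assumes "\<forall>R \<in> set Rs. nonzero_cring R" and "Rs \<noteq> []"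
  shows "nonzero_cring (RDirProd_list Rs)"
proof (intro nonzero_cring.intro nonzero_cring_axioms.intro)
  show "cring (RDirProd_list Rs)"
    using assms by (intro RDirProd_list_cring) (auto simp: nonzero_cring_def)
  show "\<one>\<^bsub>RDirProd_list Rs\<^esub> \<noteq> \<zero>\<^bsub>RDirProd_list Rs\<^esub>"
    using assms by (cases Rs)
      (auto simp: RDirProd_list_Cons_one RDirProd_list_zero' nonzero_cring.one_neq_zero)
qed

theorem proposition2p2:
  fixes As :: "('a, 'm) ring_scheme list" and n :: nat
  assumes "n \<ge> 1" and "length As = n"
    and "\<And>i. i < n \<Longrightarrow> nonzero_cring (As ! i)"
  shows "ISP_ring (RDirProd_list As) \<longleftrightarrow> (\<forall>i < n. ISP_ring (As ! i))"
proof -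
  have ISP_iff: "ISP_ring A \<longleftrightarrow> nonzero_cring A \<and> factors_regular_ideals A"
    for A :: "('b, 'k) ring_scheme"
    by (simp add: ISP_ring_def factors_regular_ideals_def)
  have As: "\<forall>R \<in> set As. nonzero_cring R" "As \<noteq> []"
    using assms by (auto simp: in_set_conv_nth)
  \<comment> \<open>The product of a nonempty list of nonzero rings is nonzero, so only the
    factorization condition is left to compare.\<close>
  then have "ISP_ring (RDirProd_list As) \<longleftrightarrow> (\<forall>R \<in> set As. factors_regular_ideals R)"
    using RDirProd_list_nonzero_cring[OF As] factors_regular_ideals_RDirProd_list[of As]
    by (simp add: ISP_ring_def factors_regular_ideals_def nonzero_cring_def)
  also have "\<dots> \<longleftrightarrow> (\<forall>R \<in> set As. ISP_ring R)"
    using As by (auto simp: ISP_iff)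
  finally show ?thesis using assms(2) by (simp add: all_set_conv_all_nth)
qed

end
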